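(* For a soft covering approximation space $S=(U,C_G)$ with finite parameter set, equip $U$ with the topology generated by $C_G$ as a subbase and let $\operatorname{cl}$ denote the closure in this topology. In general the soft covering upper approximation $S^-(X)$ of a subset $X\subseteq U$ cannot be compared with $\operatorname{cl}(X)$, i.e. neither inclusion holds in general: there exist a soft covering approximation space $S=(U,C_G)$ with finite parameter set and a subset $X\subseteq U$ with $\operatorname{cl}(X)\not\subseteq S^-(X)$, and there exist a soft covering approximation space $S=(U,C_G)$ with finite parameter set and a subset $Y\subseteq U$ with $S^-(Y)\not\subseteq\operatorname{cl}(Y)$.
   Context: A soft set over $U$ is a pair $G=(F,E)$ with $E$ a set (the parameter set) and $F:E\to P(U)$ a map into the power set of $U$. It is a covering soft set if $\bigcup_{e\in E}F(e)=U$ and $F(e)\neq\emptyset$ for every $e\in E$. For a covering soft set $G$ write $C_G=\{F(e):e\in E\}$; the pair $S=(U,C_G)$ is called a soft covering approximation space. For $x\in U$ the soft minimal description of $x$ is $Md_S(x)=\{F(e): e\in E,\ x\in F(e),\text{ and for all } a\in E,\ x\in F(a)\subseteq F(e)\text{ implies }F(a)=F(e)\}$. For $X\subseteq U$ the soft covering lower approximation is $S_-(X)=\bigcup\{F(e): e\in E,\ F(e)\subseteq X\}$ and the soft covering upper approximation is $S^-(X)=S_-(X)\cup\bigcup_{x\in X\setminus S_-(X)}\ \bigcup_{K\in Md_S(x)}K$. *)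

theory Defs
  imports "HOL-Analysis.Analysis"
begin

text \<open>
  A soft set \<open>G = (F, E)\<close> over \<open>U\<close> is given by a total function \<open>F\<close> together with its
  parameter set \<open>E\<close>; the values of \<open>F\<close> outside \<open>E\<close> are never used.
\<close>

definition soft_set :: "'a set \<Rightarrow> ('e \<Rightarrow> 'a set) \<Rightarrow> 'e set \<Rightarrow> bool" where
  "soft_set U F E \<longleftrightarrow> F \<in> E \<rightarrow> Pow U"

definition covering_soft_set :: "'a set \<Rightarrow> ('e \<Rightarrow> 'a set) \<Rightarrow> 'e set \<Rightarrow> bool" where
  "covering_soft_set U F E \<longleftrightarrow>
     soft_set U F E \<and> (\<Union>e\<in>E. F e) = U \<and> (\<forall>e\<in>E. F e \<noteq> {})"

definition soft_cover :: "('e \<Rightarrow> 'a set) \<Rightarrow> 'e set \<Rightarrow> 'a set set" where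
  "soft_cover F E = {F e | e. e \<in> E}"

definition soft_min_descr :: "('e \<Rightarrow> 'a set) \<Rightarrow> 'e set \<Rightarrow> 'a \<Rightarrow> 'a set set" where
  "soft_min_descr F E x =
     {F e | e. e \<in> E \<and> x \<in> F e \<and> (\<forall>a\<in>E. x \<in> F a \<and> F a \<subseteq> F e \<longrightarrow> F a = F e)}"

definition soft_lower :: "('e \<Rightarrow> 'a set) \<Rightarrow> 'e set \<Rightarrow> 'a set \<Rightarrow> 'a set" where
  "soft_lower F E X = \<Union>{F e | e. e \<in> E \<and> F e \<subseteq> X}"

definition soft_upper :: "('e \<Rightarrow> 'a set) \<Rightarrow> 'e set \<Rightarrow> 'a set \<Rightarrow> 'a set" where
  "soft_upper F E X =
     soft_lower F E X \<union> (\<Union>x \<in> X - soft_lower F E X. \<Union>K \<in> soft_min_descr F E x. K)"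

definition soft_topology :: "('e \<Rightarrow> 'a set) \<Rightarrow> 'e set \<Rightarrow> 'a topology" where
  "soft_topology F E = topology_generated_by (soft_cover F E)"

text \<open>The underlying set of the generated topology is the union of the subbase, hence \<open>U\<close>.\<close>

lemma topspace_soft_topology:
  assumes "covering_soft_set U F E"
  shows "topspace (soft_topology F E) = U"
  using assms unfolding soft_topology_def covering_soft_set_def soft_cover_def by auto

end

theory Submission
  imports Defs
begin

text \<open>
  Both witnesses live on the Sierpinski space: the cover of \<open>{0, 1}\<close> by \<open>{0}\<close> and \<open>{0, 1}\<close>
  is encoded as \<open>F = atMost\<close> on \<open>E = {..1}\<close>. The definable set \<open>{0}\<close> is its own upper
  approximation but is dense, whereas \<open>{1}\<close> is closed but its upper approximation is everything.
\<close>

text \<open>The specialization preorder can be tested on a subbase: the passage from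
  \<open>x\<close> to \<open>y\<close> survives binary intersections and arbitrary unions.\<close>

lemma generate_topology_on_mono_point:
  assumes "generate_topology_on \<S> T" "x \<in> T" "\<And>S. S \<in> \<S> \<Longrightarrow> x \<in> S \<Longrightarrow> y \<in> S"
  shows "y \<in> T"
  using assms by (induction rule: generate_topology_on.induct) auto

text \<open>Every open neighbourhood of \<open>x\<close> catches \<open>y\<close>; the first
  assumption only places \<open>x\<close> in the space.\<close>

lemma in_closure_of_singleton_topology_generated_by:
  assumes "x \<in> \<Union>\<S>" "\<And>S. S \<in> \<S> \<Longrightarrow> x \<in> S \<Longrightarrow> y \<in> S"
  shows "x \<in> topology_generated_by \<S> closure_of {y}"
  using assms generate_topology_on_mono_point[of \<S> _ x y]
  by (auto simp: in_closure_of openin_topology_generated_by_iff)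

lemma covering_soft_set_atMost: "covering_soft_set {..n::nat} atMost {..n}"
  unfolding covering_soft_set_def soft_set_def by fastforce

lemma soft_cover_atMost: "soft_cover atMost {..1::nat} = {{0}, {0, 1}}"
proof -
  have "soft_cover atMost {..1::nat} = atMost ` {0, 1}"
    unfolding soft_cover_def by (auto simp: le_Suc_eq)
  also have "\<dots> = {{0}, {0, 1}}"
    by auto
  finally show ?thesis .
qed

theorem proposition29:
  shows "(\<exists>(U :: nat set) (F :: nat \<Rightarrow> nat set) (E :: nat set) X.
            covering_soft_set U F E \<and> finite E \<and> X \<subseteq> U \<and>
            \<not> (soft_topology F E) closure_of X \<subseteq> soft_upper F E X)
       \<and> (\<exists>(U :: nat set) (F :: nat \<Rightarrow> nat set) (E :: nat set) Y.
            covering_soft_set U F E \<and> finite E \<and> Y \<subseteq> U \<and>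
            \<not> soft_upper F E Y \<subseteq> (soft_topology F E) closure_of Y)"
proof -
  let ?F = "atMost :: nat \<Rightarrow> nat set" and ?E = "{..1::nat}"
  have "1 \<in> soft_topology ?F ?E closure_of {0}"
    unfolding soft_topology_def soft_cover_atMost
    by (rule in_closure_of_singleton_topology_generated_by) auto
  \<comment> \<open>As a cover member, \<open>{0}\<close> equals its lower approximation, so no
    minimal description is added.\<close>
  moreover have "1 \<notin> soft_upper ?F ?E {0}"
    unfolding soft_upper_def soft_lower_def by auto
  ultimately have 1: "\<not> soft_topology ?F ?E closure_of {0} \<subseteq> soft_upper ?F ?E {0}"
    by blast
  \<comment> \<open>Minimality is automatic: \<open>?F 1\<close> is the only cover member containing
    \<open>1\<close>.\<close>
  have "?F 1 \<in> soft_min_descr ?F ?E 1"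
    unfolding soft_min_descr_def by force
  moreover have "1 \<notin> soft_lower ?F ?E {1}"
    unfolding soft_lower_def by auto
  moreover have "0 \<in> ?F 1"
    by simp
  ultimately have "0 \<in> soft_upper ?F ?E {1}"
    unfolding soft_upper_def by blast
  \<comment> \<open>This subbasic set separates \<open>0\<close> from \<open>{1}\<close>.\<close>
  moreover have "openin (soft_topology ?F ?E) {0}"
    unfolding soft_topology_def soft_cover_atMost
    by (rule topology_generated_by_Basis) simp
  then have "0 \<notin> soft_topology ?F ?E closure_of {1}"
    by (auto simp: in_closure_of)
  ultimately have 2: "\<not> soft_upper ?F ?E {1} \<subseteq> soft_topology ?F ?E closure_of {1}"
    by blast
  have "{0} \<subseteq> ?E" "{1} \<subseteq> ?E"
    by auto
  then show ?thesis
    using covering_soft_set_atMost[of 1] finite_atMost[of "1::nat"] 1 2 by blast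
qed

end
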